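(* Let $F:\mathbb{C}^n\to\mathbb{C}^n$ be a polynomial mapping, let $K_0(F)$ be its set of critical values and $S_F$ its asymptotic set. Then the set $K_0(F)\cup S_F$ is closed in $\mathbb{C}^n$. Moreover, $$K_0(F)\cup S_F=\overline{K_0(F)}\cup S_F .$$
   Context: $K_0(F)$ is the set of critical values of $F$, i.e. $K_0(F)=F(\{x\in\mathbb{C}^n:\det J_F(x)=0\})$, where $J_F(x)$ is the complex Jacobian matrix of $F$ at $x$. The asymptotic set is $S_F=\{a\in\mathbb{C}^n:\exists\ (x_k)_{k\in\mathbb{N}}\subset\mathbb{C}^n,\ |x_k|\to\infty \text{ and } F(x_k)\to a\}$. The bar denotes closure in $\mathbb{C}^n$ for the Euclidean topology. *)

theory Defs
  imports "HOL-Analysis.Analysis"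
begin

text \<open>Multi-indices are functions \<open>'n \<Rightarrow> nat\<close>; polynomials here have complex coefficients and no
  conjugated variables, unlike the library's \<open>polynomial_function\<close>, which on \<open>complex ^ 'n\<close>
  means a polynomial in the real and imaginary parts.\<close>

definition is_complex_poly :: "(complex ^ 'n \<Rightarrow> complex) \<Rightarrow> bool" where
  "is_complex_poly f \<longleftrightarrow>
     (\<exists>(A :: ('n \<Rightarrow> nat) set) (c :: ('n \<Rightarrow> nat) \<Rightarrow> complex).
        finite A \<and> (\<forall>x. f x = (\<Sum>\<alpha>\<in>A. c \<alpha> * (\<Prod>i\<in>UNIV. (x $ i) ^ \<alpha> i))))"

definition polynomial_mapping :: "(complex ^ 'n \<Rightarrow> complex ^ 'm) \<Rightarrow> bool" where
  "polynomial_mapping F \<longleftrightarrow> (\<forall>i. is_complex_poly (\<lambda>x. F x $ i))"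

text \<open>Entry \<open>(i, j)\<close> is the complex partial derivative of \<open>F\<^sub>i\<close> with respect to \<open>z\<^sub>j\<close> at \<open>x\<close>, i.e.
  the complex derivative of the one-variable function obtained by letting the \<open>j\<close>-th
  coordinate vary and fixing the others. It always exists for polynomial mappings.\<close>

definition complex_jacobian ::
    "(complex ^ 'n \<Rightarrow> complex ^ 'm) \<Rightarrow> complex ^ 'n \<Rightarrow> complex ^ 'n ^ 'm" where
  "complex_jacobian F x =
     (\<chi> i j. deriv (\<lambda>t. F (\<chi> k. if k = j then t else x $ k) $ i) (x $ j))"

definition critical_values :: "(complex ^ 'n \<Rightarrow> complex ^ 'n) \<Rightarrow> (complex ^ 'n) set" where
  "critical_values F = F ` {x. det (complex_jacobian F x) = 0}"

definition asymptotic_set :: "(complex ^ 'n \<Rightarrow> complex ^ 'n) \<Rightarrow> (complex ^ 'n) set" where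
  "asymptotic_set F =
     {a. \<exists>x :: nat \<Rightarrow> complex ^ 'n.
           filterlim (\<lambda>k. norm (x k)) at_top sequentially \<and> (\<lambda>k. F (x k)) \<longlonglongrightarrow> a}"

end

theory Submission
  imports Defs
begin

text \<open>The asymptotic set is the intersection over \<open>R\<close> of the closures of \<open>F ` {x. norm x > R}\<close>, so it
  is closed. For closed \<open>C\<close>, the image under \<open>F\<close> of the compact part of \<open>C\<close> within norm \<open>R\<close> is closed,
  so a point in the closure of \<open>F ` C\<close> outside \<open>F ` C\<close> lies in each of these closures. It remains to
  apply this to the zero set of the Jacobian determinant.\<close>

text \<open>A sequence tending to infinity eventually leaves every ball, so its image limit lies in
  each closure. Conversely, a point of all the closures is the limit along a sequence picked from
  ever smaller neighbourhoods over ever larger radii.\<close>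

lemma asymptotic_set_eq_Inter_closure:
  fixes F :: "complex ^ 'n \<Rightarrow> complex ^ 'n"
  shows "asymptotic_set F = (\<Inter>R. closure (F ` {x. norm x > R}))"
proof (intro equalityI subsetI INT_I)
  fix a and R :: real
  assume "a \<in> asymptotic_set F"
  then obtain x where x: "filterlim (\<lambda>k. norm (x k)) at_top sequentially"
    and lim: "(\<lambda>k. F (x k)) \<longlonglongrightarrow> a"
    by (auto simp: asymptotic_set_def)
  have "\<forall>\<^sub>F k in sequentially. norm (x k) > R"
    using x by (simp add: filterlim_at_top_dense)
  then have "\<forall>\<^sub>F k in sequentially. F (x k) \<in> closure (F ` {x. norm x > R})"
    by eventually_elim (meson closure_subset imageI mem_Collect_eq subsetD)
  then show "a \<in> closure (F ` {x. norm x > R})"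
    by (rule Lim_in_closed_set[OF closed_closure _ _ lim]) simp
next
  fix a
  assume a: "a \<in> (\<Inter>R. closure (F ` {x. norm x > R}))"
  \<comment> \<open>Coupling the radius \<open>k\<close> with the tolerance 1/(k+1) makes one choice
    of points serve both limits; \<open>Suc\<close> keeps the tolerance positive at
    \<open>k = 0\<close>.\<close>
  have "\<exists>x. norm x > real k \<and> dist (F x) a < inverse (real (Suc k))" for k
  proof -
    have "a \<in> closure (F ` {x. norm x > real k})"
      using a by blast
    then show ?thesis
      unfolding closure_approachable
      by (metis (mono_tags, lifting) imageE inverse_positive_iff_positive mem_Collect_eq
          of_nat_0_less_iff zero_less_Suc)
  qed
  then obtain x where x: "\<And>k. norm (x k) > real k"
    and d: "\<And>k. dist (F (x k)) a < inverse (real (Suc k))"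
    by metis
  have "filterlim (\<lambda>k. norm (x k)) at_top sequentially"
    by (rule filterlim_at_top_mono[OF filterlim_real_sequentially])
      (simp add: x less_imp_le)
  moreover have "(\<lambda>k. F (x k)) \<longlonglongrightarrow> a"
    unfolding tendsto_dist_iff[of _ a]
    by (rule real_tendsto_sandwich[OF _ _ tendsto_const LIMSEQ_inverse_real_of_nat])
      (use d in \<open>auto intro!: always_eventually less_imp_le\<close>)
  ultimately show "a \<in> asymptotic_set F"
    by (auto simp: asymptotic_set_def)
qed

lemma closed_asymptotic_set: "closed (asymptotic_set F)"
  by (simp add: asymptotic_set_eq_Inter_closure closed_INT)

lemma closure_image_subset_asymptotic_set:
  fixes F :: "complex ^ 'n \<Rightarrow> complex ^ 'n"
  assumes F: "continuous_on UNIV F" and C: "closed C"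
  shows "closure (F ` C) \<subseteq> F ` C \<union> asymptotic_set F"
proof -
  have "closure (F ` C) \<subseteq> F ` C \<union> closure (F ` {x. norm x > R})" for R
  proof -
    have "compact (F ` (C \<inter> cball 0 R))"
      using C by (intro compact_continuous_image closed_Int_compact
          continuous_on_subset[OF F]) auto
    then have "closed (F ` (C \<inter> cball 0 R) \<union> closure (F ` {x. norm x > R}))"
      by (simp add: compact_imp_closed closed_Un)
    moreover have "F ` C \<subseteq> F ` (C \<inter> cball 0 R) \<union> closure (F ` {x. norm x > R})"
    proof
      fix y assume "y \<in> F ` C"
      then obtain x where x: "x \<in> C" "y = F x" by blast
      show "y \<in> F ` (C \<inter> cball 0 R) \<union> closure (F ` {x. norm x > R})"
        using x closure_subset[of "F ` {x. norm x > R}"]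
        by (cases "norm x > R") auto
    qed
    ultimately have "closure (F ` C) \<subseteq> F ` (C \<inter> cball 0 R) \<union> closure (F ` {x. norm x > R})"
      by (rule closure_minimal[rotated])
    then show ?thesis by blast
  qed
  then show ?thesis
    unfolding asymptotic_set_eq_Inter_closure by blast
qed

lemma is_complex_poly_continuous_on:
  assumes "is_complex_poly f"
  shows "continuous_on UNIV f"
proof -
  obtain A c where "f = (\<lambda>x. \<Sum>\<alpha>\<in>A. c \<alpha> * (\<Prod>i\<in>UNIV. (x $ i) ^ \<alpha> i))"
    using assms unfolding is_complex_poly_def by blast
  then show ?thesis by (auto intro!: continuous_intros)
qed

lemma polynomial_mapping_continuous_on:
  assumes "polynomial_mapping F"
  shows "continuous_on UNIV F"
proof -
  have "continuous_on UNIV (\<lambda>x. \<chi> i. F x $ i)"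
    using assms unfolding polynomial_mapping_def
    by (intro continuous_on_vec_lambda is_complex_poly_continuous_on) auto
  then show ?thesis by simp
qed

text \<open>Termwise differentiation gives an explicit polynomial in \<open>x\<close>, whose
  continuity is immediate. This handles each entry of the Jacobian.\<close>

lemma is_complex_poly_continuous_on_partial_deriv:
  fixes f :: "complex ^ 'n \<Rightarrow> complex"
  assumes "is_complex_poly f"
  shows "continuous_on UNIV (\<lambda>x. deriv (\<lambda>t. f (\<chi> k. if k = j then t else x $ k)) (x $ j))"
proof -
  obtain A c where f: "f = (\<lambda>x. \<Sum>\<alpha>\<in>A. c \<alpha> * (\<Prod>i\<in>UNIV. (x $ i) ^ \<alpha> i))"
    using assms unfolding is_complex_poly_def by blast
  \<comment> \<open>Splitting off the factor \<open>i = j\<close> leaves a polynomial in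
    \<open>t\<close> whose coefficients do not involve \<open>t\<close>.\<close>
  have eq: "f (\<chi> k. if k = j then t else x $ k) =
      (\<Sum>\<alpha>\<in>A. c \<alpha> * (t ^ \<alpha> j * (\<Prod>i\<in>UNIV - {j}. (x $ i) ^ \<alpha> i)))" for t x
    unfolding f by (subst prod.remove[of _ j]) (auto intro!: sum.cong prod.cong)
  \<comment> \<open>If \<open>\<alpha> j = 0\<close>, the truncated exponent
    \<open>\<alpha> j - 1\<close> is 0, but the factor \<open>of_nat (\<alpha> j)\<close> makes the
    term vanish, as it should.\<close>
  have "deriv (\<lambda>t. f (\<chi> k. if k = j then t else x $ k)) (x $ j) =
      (\<Sum>\<alpha>\<in>A. c \<alpha> * (of_nat (\<alpha> j) * (x $ j) ^ (\<alpha> j - 1) * (\<Prod>i\<in>UNIV - {j}. (x $ i) ^ \<alpha> i)))" for x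
    unfolding eq by (intro DERIV_imp_deriv) (auto intro!: derivative_eq_intros sum.cong)
  then show ?thesis by (auto intro!: continuous_intros)
qed

lemma closed_singular_points:
  fixes F :: "complex ^ 'n \<Rightarrow> complex ^ 'n"
  assumes "polynomial_mapping F"
  shows "closed {x. det (complex_jacobian F x) = 0}"
proof -
  have "continuous_on UNIV (\<lambda>x. complex_jacobian F x $ i $ j)" for i j
    unfolding complex_jacobian_def vec_lambda_beta
    by (rule is_complex_poly_continuous_on_partial_deriv)
      (use assms in \<open>auto simp: polynomial_mapping_def\<close>)
  \<comment> \<open>By the Leibniz formula the determinant is a finite sum of products of
    entries.\<close>
  then have "continuous_on UNIV (\<lambda>x. det (complex_jacobian F x))"
    unfolding det_def by (intro continuous_on_sum continuous_on_mult continuous_on_prod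
        continuous_on_const)
  then show ?thesis
    by (intro closed_Collect_eq continuous_on_const)
qed

theorem proposition4p2:
  fixes F :: "complex ^ 'n \<Rightarrow> complex ^ 'n"
  assumes "polynomial_mapping F"
  shows "closed (critical_values F \<union> asymptotic_set F) \<and>
         critical_values F \<union> asymptotic_set F = closure (critical_values F) \<union> asymptotic_set F"
proof -
  have "closure (critical_values F) \<subseteq> critical_values F \<union> asymptotic_set F"
    unfolding critical_values_def
    using assms by (intro closure_image_subset_asymptotic_set polynomial_mapping_continuous_on
        closed_singular_points)
  then have eq: "critical_values F \<union> asymptotic_set F = closure (critical_values F) \<union> asymptotic_set F"
    using closure_subset[of "critical_values F"] by blast
  \<comment> \<open>Closedness is read off the right-hand side of \<open>eq\<close>, a union of two
    closed sets.\<close>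
  then show ?thesis
    by (simp add: closed_Un closed_asymptotic_set)
qed

end
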